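(* Let $\mathbf{o}$ be a partitioned stateful operator. If inputs to $\mathbf{o}$ are added using the procedure addInput, and the workers allotted to $\mathbf{o}$ consume inputs by invoking the procedure consumeInputs (both procedures being those of the hybrid-queue scheme given in the context), then the following properties hold: (1) No two workers can operate on tuples having the same key $k$ concurrently. (2) All tuples that have the same key $k$ are processed exactly once and in the order of their arrival.
   Context: Partitioned stateful operator: every input tuple has a key, the states required to process inputs with different keys are disjoint, and a fixed function maps keys to finitely many partitions. getPartition(tuple) denotes the partition of the tuple's key, so tuples with the same key always have the same partition. operate(tuple) is the operator's processing of one tuple; a tuple is processed when operate is executed on it. Model. Several workers (threads) and the upstream producer run concurrently on shared memory. Operations on the shared objects below are atomic (linearizable) and sequentially consistent. $x$.fetch_add(1) and $x$.fetch_sub(1) atomically increment, respectively decrement, $x$ and return the value held before the operation. Queues are linearizable concurrent FIFO queues: enqueue adds an element at the tail; tryDequeue($x$) removes the head element, stores it in $x$ and returns true if the queue is non-empty, and otherwise returns false. Shared data: one FIFO queue masterQueue (of partition identifiers), initially empty; for each partition $p$, a FIFO queue partitionQueues$[p]$ (of tuples), initially empty, and an atomic integer counter count$[p]$, initially 0. addInput(tuple) (invoked by the upstream operator for each input tuple; inputs are added by only a single worker of the upstream operator at a time): 1. $p$ := getPartition(tuple) 2. partitionQueues$[p]$.enqueue(tuple) 3. masterQueue.enqueue($p$) consumeInputs() (invoked by the workers allotted to the operator): while masterQueue.tryDequeue($p$) returns true: if count$[p]$.fetch_add(1) returns 0: do partitionQueues$[p]$.tryDequeue(tuple); operate(tuple)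 while count$[p]$.fetch_sub(1) returns a value $>1$ The variables $p$ and tuple are local to each invocation. Arrival order: for tuples of the same partition $p$, the order in which they are enqueued into partitionQueues$[p]$.
   Formalization: That every added tuple is actually processed is claimed only for fair executions: no started invocation (including operate) stalls forever, and workers do not forever refrain from invoking consumeInputs while masterQueue is non-empty; otherwise a tuple may never be processed. *)

theory Defs
  imports Main
begin

text \<open>
  The last argument gives the part of the operator's state that operate requires for a tuple.
\<close>

definition partitioned_stateful_operator ::
    "('d \<Rightarrow> 'k) \<Rightarrow> ('k \<Rightarrow> 'p) \<Rightarrow> ('d \<Rightarrow> 's set) \<Rightarrow> bool" where
  "partitioned_stateful_operator getKey partitionOf requiredState \<longleftrightarrow>
     (\<forall>d d'. getKey d \<noteq> getKey d' \<longrightarrow> requiredState d \<inter> requiredState d' = {}) \<and>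
     finite (range partitionOf)"

definition getPartition :: "('d \<Rightarrow> 'k) \<Rightarrow> ('k \<Rightarrow> 'p) \<Rightarrow> 'd \<Rightarrow> 'p" where
  "getPartition getKey partitionOf d = partitionOf (getKey d)"

text \<open>
  An input tuple is paired with the number of the addInput invocation that adds it. The number is
  never read by the procedures; it only keeps apart several input tuples carrying equal data.
\<close>

type_synonym 'd input = "nat \<times> 'd"

text \<open>
  Program counters name the next atomic action. The exception is \<open>Operating\<close>: an execution of
  operate is not atomic, and a worker is at \<open>Operating\<close> from its start to its end.
\<close>

datatype upstream_pc = NotAdding | GetPartition | EnqueuePartition | EnqueueMaster

datatype worker_pc =
  NotConsuming | DequeueMaster | FetchAdd | DequeuePartition | CallOperate | Operating | FetchSub

record ('p, 'd) upstream_state =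
  upc :: upstream_pc
  up :: 'p
  utuple :: "'d input"

record ('p, 'd) worker_state =
  wpc :: worker_pc
  wp :: 'p
  wtuple :: "'d input"

text \<open>
  There is a single upstream component because at most one invocation of addInput is in progress
  at any time. Lists represent queues with the head first. \<open>calls\<close> is the number of invocations of
  addInput so far.
\<close>

record ('w, 'p, 'd) state =
  masterQueue :: "'p list"
  partitionQueues :: "'p \<Rightarrow> 'd input list"
  count :: "'p \<Rightarrow> int"
  upstream :: "('p, 'd) upstream_state"
  worker :: "'w \<Rightarrow> ('p, 'd) worker_state"
  calls :: nat

text \<open>\<open>Arrive\<close> is the enqueueing of a tuple into its partition queue.\<close>

datatype ('w, 'd) action =
    Stutter
  | CallAddInput "'d input"
  | Arrive "'d input"
  | UpstreamStep
  | OperateBegin 'w "'d input"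
  | OperateEnd 'w "'d input"
  | WorkerStep 'w

fun by_upstream :: "('w, 'd) action \<Rightarrow> bool" where
  "by_upstream (CallAddInput x) = True"
| "by_upstream (Arrive x) = True"
| "by_upstream UpstreamStep = True"
| "by_upstream _ = False"

fun by_worker :: "'w \<Rightarrow> ('w, 'd) action \<Rightarrow> bool" where
  "by_worker w (OperateBegin v x) = (v = w)"
| "by_worker w (OperateEnd v x) = (v = w)"
| "by_worker w (WorkerStep v) = (v = w)"
| "by_worker w _ = False"

definition set_worker ::
    "'w \<Rightarrow> ('p, 'd) worker_state \<Rightarrow> ('w, 'p, 'd) state \<Rightarrow> ('w, 'p, 'd) state" where
  "set_worker w l s = s\<lparr>worker := (worker s)(w := l)\<rparr>"

definition initial :: "('w, 'p, 'd) state \<Rightarrow> bool" where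
  "initial s \<longleftrightarrow>
     masterQueue s = [] \<and> (\<forall>p. partitionQueues s p = []) \<and> (\<forall>p. count s p = 0) \<and>
     upc (upstream s) = NotAdding \<and> (\<forall>w. wpc (worker s w) = NotConsuming) \<and> calls s = 0"

text \<open>
  Local variables have arbitrary values at the start of an invocation. A tryDequeue on an empty
  partition queue leaves the local variable tuple unchanged, and operate is then executed on that
  old (possibly never assigned) value, since the procedure ignores the returned truth value.
\<close>

inductive step ::
    "('d \<Rightarrow> 'p) \<Rightarrow> ('w, 'p, 'd) state \<Rightarrow> ('w, 'd) action \<Rightarrow> ('w, 'p, 'd) state \<Rightarrow> bool"
  for part :: "'d \<Rightarrow> 'p" where
  stutter: "step part s Stutter s"
| add_call:
    "upc (upstream s) = NotAdding \<Longrightarrow> x = (calls s, d) \<Longrightarrow>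
     step part s (CallAddInput x)
       (s\<lparr>upstream := \<lparr>upc = GetPartition, up = p0, utuple = x\<rparr>, calls := Suc (calls s)\<rparr>)"
| add_get_partition:
    "upstream s = u \<Longrightarrow> upc u = GetPartition \<Longrightarrow>
     step part s UpstreamStep
       (s\<lparr>upstream := u\<lparr>upc := EnqueuePartition, up := part (snd (utuple u))\<rparr>\<rparr>)"
| add_enqueue_partition:
    "upstream s = u \<Longrightarrow> upc u = EnqueuePartition \<Longrightarrow>
     step part s (Arrive (utuple u))
       (s\<lparr>partitionQueues :=
            (partitionQueues s)(up u := partitionQueues s (up u) @ [utuple u]),
          upstream := u\<lparr>upc := EnqueueMaster\<rparr>\<rparr>)"
| add_enqueue_master:
    "upstream s = u \<Longrightarrow> upc u = EnqueueMaster \<Longrightarrow>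
     step part s UpstreamStep
       (s\<lparr>masterQueue := masterQueue s @ [up u], upstream := u\<lparr>upc := NotAdding\<rparr>\<rparr>)"
| consume_call:
    "wpc (worker s w) = NotConsuming \<Longrightarrow>
     step part s (WorkerStep w)
       (set_worker w \<lparr>wpc = DequeueMaster, wp = p0, wtuple = x0\<rparr> s)"
| dequeue_master:
    "worker s w = l \<Longrightarrow> wpc l = DequeueMaster \<Longrightarrow> masterQueue s = p # ps \<Longrightarrow>
     step part s (WorkerStep w)
       (set_worker w (l\<lparr>wpc := FetchAdd, wp := p\<rparr>) (s\<lparr>masterQueue := ps\<rparr>))"
| dequeue_master_empty:
    "worker s w = l \<Longrightarrow> wpc l = DequeueMaster \<Longrightarrow> masterQueue s = [] \<Longrightarrow>
     step part s (WorkerStep w) (set_worker w (l\<lparr>wpc := NotConsuming\<rparr>) s)"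
| fetch_add:
    "worker s w = l \<Longrightarrow> wpc l = FetchAdd \<Longrightarrow> count s (wp l) = c \<Longrightarrow>
     step part s (WorkerStep w)
       (set_worker w (l\<lparr>wpc := (if c = 0 then DequeuePartition else DequeueMaster)\<rparr>)
         (s\<lparr>count := (count s)(wp l := c + 1)\<rparr>))"
| dequeue_partition:
    "worker s w = l \<Longrightarrow> wpc l = DequeuePartition \<Longrightarrow> partitionQueues s (wp l) = x # xs \<Longrightarrow>
     step part s (WorkerStep w)
       (set_worker w (l\<lparr>wpc := CallOperate, wtuple := x\<rparr>)
         (s\<lparr>partitionQueues := (partitionQueues s)(wp l := xs)\<rparr>))"
| dequeue_partition_empty:
    "worker s w = l \<Longrightarrow> wpc l = DequeuePartition \<Longrightarrow> partitionQueues s (wp l) = [] \<Longrightarrow>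
     step part s (WorkerStep w) (set_worker w (l\<lparr>wpc := CallOperate\<rparr>) s)"
| operate_begin:
    "worker s w = l \<Longrightarrow> wpc l = CallOperate \<Longrightarrow>
     step part s (OperateBegin w (wtuple l)) (set_worker w (l\<lparr>wpc := Operating\<rparr>) s)"
| operate_end:
    "worker s w = l \<Longrightarrow> wpc l = Operating \<Longrightarrow>
     step part s (OperateEnd w (wtuple l)) (set_worker w (l\<lparr>wpc := FetchSub\<rparr>) s)"
| fetch_sub:
    "worker s w = l \<Longrightarrow> wpc l = FetchSub \<Longrightarrow> count s (wp l) = c \<Longrightarrow>
     step part s (WorkerStep w)
       (set_worker w (l\<lparr>wpc := (if c > 1 then DequeuePartition else DequeueMaster)\<rparr>)
         (s\<lparr>count := (count s)(wp l := c - 1)\<rparr>))"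

text \<open>\<open>\<alpha> i\<close> is the action leading from state \<open>\<sigma> i\<close> to state \<open>\<sigma> (Suc i)\<close>.\<close>

definition run ::
    "('d \<Rightarrow> 'p) \<Rightarrow> (nat \<Rightarrow> ('w, 'p, 'd) state) \<Rightarrow> (nat \<Rightarrow> ('w, 'd) action) \<Rightarrow> bool" where
  "run part \<sigma> \<alpha> \<longleftrightarrow>
     initial (\<sigma> 0) \<and> (\<forall>i. step part (\<sigma> i) (\<alpha> i) (\<sigma> (Suc i)))"

text \<open>
  No invocation in progress is suspended forever (in particular, executions of operate terminate),
  and the workers do not forever refrain from invoking consumeInputs while the master queue is
  non-empty.
\<close>

definition fair ::
    "(nat \<Rightarrow> ('w, 'p, 'd) state) \<Rightarrow> (nat \<Rightarrow> ('w, 'd) action) \<Rightarrow> bool" where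
  "fair \<sigma> \<alpha> \<longleftrightarrow>
     (\<forall>i. upc (upstream (\<sigma> i)) \<noteq> NotAdding \<longrightarrow> (\<exists>j\<ge>i. by_upstream (\<alpha> j))) \<and>
     (\<forall>w i. wpc (worker (\<sigma> i) w) \<noteq> NotConsuming \<longrightarrow> (\<exists>j\<ge>i. by_worker w (\<alpha> j))) \<and>
     (\<forall>i. \<exists>j\<ge>i. masterQueue (\<sigma> j) = [] \<or> (\<exists>w. wpc (worker (\<sigma> j) w) \<noteq> NotConsuming))"

definition operating_on :: "('w, 'p, 'd) state \<Rightarrow> 'w \<Rightarrow> 'd input \<Rightarrow> bool" where
  "operating_on s w x \<longleftrightarrow> wpc (worker s w) = Operating \<and> wtuple (worker s w) = x"

end

theory Submission
  imports Defs
begin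

text \<open>
  A partition \<open>p\<close> has a worker inside its do-while loop exactly when count \<open>p\<close> is positive, and then
  only one. A tuple is enqueued before its token, so this worker never meets an empty partition queue;
  hence the arrival sequence of \<open>p\<close> is at all times the sequence of processed tuples, followed by the
  tuple in hand, followed by the content of the queue. This gives exclusion, order and uniqueness.

  For progress, suppose a tuple of \<open>p\<close> is never finished. Then only finitely many executions of
  operate on \<open>p\<close> end, so from some time on nobody is in the loop of \<open>p\<close> and nobody executes
  fetch\_add on count \<open>p\<close>. Since tokens match waiting tuples, a token of \<open>p\<close> stays in the master
  queue forever. But the head of the master queue is always removed eventually: otherwise, as no new
  tokens are dequeued, every loop terminates and its worker returns to the master queue.
\<close>

definition busy :: "'p \<Rightarrow> ('p, 'd) worker_state \<Rightarrow> bool" where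
  "busy p l \<longleftrightarrow> wp l = p \<and> wpc l \<in> {DequeuePartition, CallOperate, Operating, FetchSub}"

definition holding :: "'p \<Rightarrow> ('p, 'd) worker_state \<Rightarrow> bool" where
  "holding p l \<longleftrightarrow> wp l = p \<and> wpc l \<in> {CallOperate, Operating, FetchSub}"

definition adding :: "'p \<Rightarrow> ('p, 'd) worker_state \<Rightarrow> bool" where
  "adding p l \<longleftrightarrow> wp l = p \<and> wpc l = FetchAdd"

definition carrying :: "'p \<Rightarrow> ('p, 'd) worker_state \<Rightarrow> bool" where
  "carrying p l \<longleftrightarrow> wp l = p \<and> wpc l \<in> {CallOperate, Operating}"

definition num :: "(('p, 'd) worker_state \<Rightarrow> bool) \<Rightarrow> ('w \<Rightarrow> ('p, 'd) worker_state) \<Rightarrow> int" where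
  "num P W = int (card {w. P (W w)})"

definition finitely_active :: "('w \<Rightarrow> ('p, 'd) worker_state) \<Rightarrow> bool" where
  "finitely_active W \<longleftrightarrow> finite {w. wpc (W w) \<noteq> NotConsuming}"

lemma finitely_active_upd: "finitely_active W \<Longrightarrow> finitely_active (W(w := l))"
  unfolding finitely_active_def
  by (rule finite_subset[of _ "insert w {w. wpc (W w) \<noteq> NotConsuming}"]) auto

lemma finite_worker_set:
  assumes "finitely_active W" "\<And>l. P l \<Longrightarrow> wpc l \<noteq> NotConsuming"
  shows "finite {w. P (W w)}"
  using assms unfolding finitely_active_def by (auto elim!: rev_finite_subset)

lemma num_upd:
  assumes "finitely_active W" "\<And>l. P l \<Longrightarrow> wpc l \<noteq> NotConsuming"
  shows "num P (W(w := l)) = num P W - of_bool (P (W w)) + of_bool (P l)"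
proof -
  let ?S = "{v. v \<noteq> w \<and> P (W v)}"
  have fin: "finite ?S"
    using finite_worker_set[OF assms] by (rule rev_finite_subset) auto
  have num: "num P V = int (card ?S) + of_bool (P (V w))" if V: "\<And>v. v \<noteq> w \<Longrightarrow> V v = W v" for V
  proof -
    have "v \<in> {v. P (V v)} \<longleftrightarrow> v \<in> (if P (V w) then insert w ?S else ?S)" for v
      using V[of v] by (cases "v = w") auto
    then have "{v. P (V v)} = (if P (V w) then insert w ?S else ?S)" by blast
    then have "num P V = int (card (if P (V w) then insert w ?S else ?S))" by (simp only: num_def)
    then show ?thesis using fin by simp
  qed
  from num[of W] num[of "W(w := l)"] show ?thesis by simp
qed

lemma num_pos:
  assumes "finitely_active W" "\<And>l. P l \<Longrightarrow> wpc l \<noteq> NotConsuming" "P (W w)"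
  shows "num P W > 0"
  using finite_worker_set[OF assms(1,2)] assms(3) by (auto simp: num_def card_gt_0_iff)

lemmas pc_defs = busy_def holding_def adding_def carrying_def

lemma pc_active:
  "busy p l \<Longrightarrow> wpc l \<noteq> NotConsuming"
  "holding p l \<Longrightarrow> wpc l \<noteq> NotConsuming"
  "adding p l \<Longrightarrow> wpc l \<noteq> NotConsuming"
  by (auto simp: pc_defs)

lemma num_pc_upd:
  assumes "finitely_active W"
  shows "num (busy p) (W(w := l)) = num (busy p) W - of_bool (busy p (W w)) + of_bool (busy p l)"
    and "num (holding p) (W(w := l)) =
      num (holding p) W - of_bool (holding p (W w)) + of_bool (holding p l)"
    and "num (adding p) (W(w := l)) =
      num (adding p) W - of_bool (adding p (W w)) + of_bool (adding p l)"
  by (rule num_upd[OF assms], erule pc_active)+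

definition owned :: "('w, 'p, 'd) state \<Rightarrow> bool" where
  "owned s \<longleftrightarrow> finitely_active (worker s) \<and>
     (\<forall>p. count s p \<ge> 0 \<and> num (busy p) (worker s) = of_bool (count s p > 0))"

lemma owned_unique:
  assumes "owned s" "busy p (worker s v)" "busy p (worker s w)"
  shows "v = w"
proof -
  have "card {w. busy p (worker s w)} \<le> 1"
  proof -
    have "num (busy p) (worker s) = of_bool (count s p > 0)"
      using assms(1) by (simp add: owned_def)
    then show ?thesis by (cases "count s p > 0") (simp_all add: num_def)
  qed
  moreover have "finite {w. busy p (worker s w)}"
    using assms(1) by (auto simp: owned_def intro!: finite_worker_set pc_active(1))
  ultimately show ?thesis using assms(2,3) by (auto simp: card_le_Suc0_iff_eq)
qed

lemma owned_count_pos: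
  assumes "owned s"
  shows "count s p > 0 \<longleftrightarrow> (\<exists>w. busy p (worker s w))"
proof -
  have fin: "finitely_active (worker s)"
    and eq: "num (busy p) (worker s) = of_bool (count s p > 0)"
    using assms by (auto simp: owned_def)
  show ?thesis
  proof
    assume "count s p > 0"
    with eq have "card {w. busy p (worker s w)} \<noteq> 0" by (simp add: num_def)
    then have "{w. busy p (worker s w)} \<noteq> {}" by (metis card.empty)
    then show "\<exists>w. busy p (worker s w)" by blast
  next
    assume "\<exists>w. busy p (worker s w)"
    then obtain w where "busy p (worker s w)" ..
    then have "num (busy p) (worker s) > 0" by (rule num_pos[OF fin, rotated]) (rule pc_active)
    with eq show "count s p > 0" by (cases "count s p > 0") simp_all
  qed
qed

lemma owned_step:
  assumes "step part s a s'" "owned s"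
  shows "owned s'"
proof -
  have fin: "finitely_active (worker s)" using assms(2) by (simp add: owned_def)
  have inv: "count s p \<ge> 0" "num (busy p) (worker s) = of_bool (count s p > 0)" for p
    using assms(2) by (simp_all add: owned_def)
  have cnt: "count s p > 0" if "busy p (worker s w)" for p w
    using that owned_count_pos[OF assms(2)] by blast
  have "count s' p \<ge> 0 \<and> num (busy p) (worker s') = of_bool (count s' p > 0)" for p
    using assms(1)
  proof cases
    case (fetch_sub w l c)
    then have "count s (wp l) > 0" by (intro cnt[of _ w]) (simp add: busy_def)
    with fetch_sub show ?thesis using inv[of p]
      by (cases "p = wp l") (simp_all add: set_worker_def num_pc_upd[OF fin] busy_def)
  next
    case (fetch_add w l c)
    then show ?thesis using inv[of p]
      by (cases "p = wp l") (simp_all add: set_worker_def num_pc_upd[OF fin] busy_def)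
  qed (use inv[of p] in \<open>simp_all add: set_worker_def num_pc_upd[OF fin] busy_def\<close>)
  moreover have "finitely_active (worker s')"
    using assms(1) fin by cases (simp_all add: set_worker_def finitely_active_upd)
  ultimately show ?thesis by (simp add: owned_def)
qed

text \<open>
  Every tuple of a partition that waits or is held by a worker is matched by a token, which is either
  about to be enqueued, in the master queue, at a worker about to execute fetch\_add, or counted.
\<close>

definition balanced :: "('w, 'p, 'd) state \<Rightarrow> bool" where
  "balanced s \<longleftrightarrow> (\<forall>p.
     int (length (partitionQueues s p)) + num (holding p) (worker s) =
     int (count_list (masterQueue s) p) + num (adding p) (worker s) + count s p +
     of_bool (upc (upstream s) = EnqueueMaster \<and> up (upstream s) = p))"

lemma queue_nonempty:
  assumes "owned s" "balanced s" "wpc (worker s w) = DequeuePartition" "wp (worker s w) = p"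
  shows "partitionQueues s p \<noteq> []"
proof -
  have w: "busy p (worker s w)" using assms by (auto simp: busy_def)
  have "{v. holding p (worker s v)} = {}"
  proof safe
    fix v assume "holding p (worker s v)"
    then have "busy p (worker s v)" by (auto simp: pc_defs)
    from owned_unique[OF assms(1) this w] \<open>holding p (worker s v)\<close> assms(3)
    show "v \<in> {}" by (auto simp: pc_defs)
  qed
  then have "num (holding p) (worker s) = 0" by (simp add: num_def)
  moreover have "num (adding p) (worker s) \<ge> 0" by (simp add: num_def)
  moreover have "count s p > 0" using w owned_count_pos[OF assms(1)] by blast
  moreover have "int (length (partitionQueues s p)) + num (holding p) (worker s) =
     int (count_list (masterQueue s) p) + num (adding p) (worker s) + count s p +
     of_bool (upc (upstream s) = EnqueueMaster \<and> up (upstream s) = p)"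
    using assms(2) unfolding balanced_def by blast
  ultimately show ?thesis by (auto simp: of_bool_def split: if_splits)
qed

lemma balanced_step:
  assumes "step part s a s'" "owned s" "balanced s"
  shows "balanced s'"
proof -
  have fin: "finitely_active (worker s)" using assms(2) by (simp add: owned_def)
  have inv: "int (length (partitionQueues s p)) + num (holding p) (worker s) =
     int (count_list (masterQueue s) p) + num (adding p) (worker s) + count s p +
     of_bool (upc (upstream s) = EnqueueMaster \<and> up (upstream s) = p)" for p
    using assms(3) unfolding balanced_def by blast
  have "int (length (partitionQueues s' p)) + num (holding p) (worker s') =
     int (count_list (masterQueue s') p) + num (adding p) (worker s') + count s' p +
     of_bool (upc (upstream s') = EnqueueMaster \<and> up (upstream s') = p)" for p
    using assms(1)
  proof cases
    case (dequeue_partition_empty w l)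
    with queue_nonempty[OF assms(2,3)] show ?thesis by blast
  next
    case (dequeue_partition w l x xs)
    with inv[of p] show ?thesis
      by (cases "p = wp l") (simp_all add: set_worker_def num_pc_upd[OF fin] holding_def adding_def)
  next
    case (dequeue_master w l q qs)
    with inv[of p] show ?thesis
      by (cases "p = q") (simp_all add: set_worker_def num_pc_upd[OF fin] holding_def adding_def)
  next
    case (fetch_add w l c)
    with inv[of p] show ?thesis
      by (cases "p = wp l") (simp_all add: set_worker_def num_pc_upd[OF fin] holding_def adding_def)
  next
    case (fetch_sub w l c)
    with inv[of p] show ?thesis
      by (cases "p = wp l") (simp_all add: set_worker_def num_pc_upd[OF fin] holding_def adding_def)
  next
    case (add_enqueue_partition u)
    with inv[of p] show ?thesis by (cases "p = up u") simp_all
  next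
    case (add_enqueue_master u)
    with inv[of p] show ?thesis by (cases "p = up u") simp_all
  qed (use inv[of p] in \<open>simp_all add: set_worker_def num_pc_upd[OF fin] holding_def adding_def\<close>)
  then show ?thesis unfolding balanced_def by blast
qed

fun arrives :: "('d \<Rightarrow> 'p) \<Rightarrow> 'p \<Rightarrow> ('w, 'd) action \<Rightarrow> 'd input list" where
  "arrives part p (Arrive x) = (if part (snd x) = p then [x] else [])"
| "arrives part p _ = []"

fun begins :: "('d \<Rightarrow> 'p) \<Rightarrow> 'p \<Rightarrow> ('w, 'd) action \<Rightarrow> 'd input list" where
  "begins part p (OperateBegin w x) = (if part (snd x) = p then [x] else [])"
| "begins part p _ = []"

fun ends :: "('d \<Rightarrow> 'p) \<Rightarrow> 'p \<Rightarrow> ('w, 'd) action \<Rightarrow> 'd input list" where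
  "ends part p (OperateEnd w x) = (if part (snd x) = p then [x] else [])"
| "ends part p _ = []"

text \<open>\<open>A p\<close> stands for the sequence of arrivals at \<open>p\<close> so far.\<close>

definition fresh :: "('d \<Rightarrow> 'p) \<Rightarrow> ('w, 'p, 'd) state \<Rightarrow> ('p \<Rightarrow> 'd input list) \<Rightarrow> bool" where
  "fresh part s A \<longleftrightarrow>
     (\<forall>p. distinct (A p) \<and> (\<forall>x\<in>set (A p). part (snd x) = p \<and> fst x < calls s)) \<and>
     (upc (upstream s) \<in> {GetPartition, EnqueuePartition} \<longrightarrow>
       fst (utuple (upstream s)) < calls s \<and> (\<forall>p. utuple (upstream s) \<notin> set (A p))) \<and>
     (upc (upstream s) = EnqueuePartition \<longrightarrow>
       up (upstream s) = part (snd (utuple (upstream s))))"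

lemma fresh_step:
  assumes "step part s a s'" "fresh part s A"
  shows "fresh part s' (\<lambda>p. A p @ arrives part p a)"
  using assms by cases (fastforce simp: fresh_def set_worker_def)+

text \<open>
  \<open>A\<close>, \<open>B\<close> and \<open>E\<close> stand for the sequences of tuples of \<open>p\<close> that have arrived, on which operate has
  begun, and on which it has ended.
\<close>

definition in_order ::
    "('w, 'p, 'd) state \<Rightarrow> 'p \<Rightarrow> 'd input list \<Rightarrow> 'd input list \<Rightarrow> 'd input list \<Rightarrow> bool" where
  "in_order s p A B E \<longleftrightarrow>
     (\<forall>w. wpc (worker s w) = CallOperate \<and> wp (worker s w) = p \<longrightarrow>
       A = E @ wtuple (worker s w) # partitionQueues s p \<and> B = E) \<and>
     (\<forall>w. wpc (worker s w) = Operating \<and> wp (worker s w) = p \<longrightarrow>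
       A = E @ wtuple (worker s w) # partitionQueues s p \<and> B = E @ [wtuple (worker s w)]) \<and>
     ((\<forall>w. \<not> carrying p (worker s w)) \<longrightarrow> A = E @ partitionQueues s p \<and> B = E)"

lemma in_order_cong:
  assumes "in_order s p A B E" "partitionQueues s' p = partitionQueues s p"
    and "\<And>v. carrying p (worker s' v) = carrying p (worker s v)"
    and "\<And>v. carrying p (worker s v) \<Longrightarrow> worker s' v = worker s v"
  shows "in_order s' p A B E"
  using assms unfolding in_order_def carrying_def by (metis insertCI)

lemma in_order_step:
  assumes "step part s a s'" "owned s" "balanced s" "fresh part s A"
    and "\<And>p. in_order s p (A p) (B p) (E p)"
  shows "in_order s' p (A p @ arrives part p a) (B p @ begins part p a) (E p @ ends part p a)"
proof -
  have unique: "v = w" if "busy p (worker s v)" "busy p (worker s w)" for v w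
    using owned_unique[OF assms(2) that] .
  have part: "part (snd x) = q" if "x \<in> set (A q)" for x q
    using assms(4) that by (simp add: fresh_def)
  have carried: "part (snd (wtuple (worker s w))) = wp (worker s w)"
    if "carrying (wp (worker s w)) (worker s w)" for w
    using that assms(5)[of "wp (worker s w)"] by (intro part) (auto simp: in_order_def carrying_def)
  note order = assms(5)[of p]
  note defs = in_order_def set_worker_def pc_defs
  show ?thesis
    using assms(1)
  proof cases
    case (add_enqueue_partition u)
    then have "up u = part (snd (utuple u))" using assms(4) by (simp add: fresh_def)
    with add_enqueue_partition order show ?thesis by (cases "up u = p") (auto simp: defs)
  next
    case (dequeue_partition w l x xs)
    show ?thesis
    proof (cases "wp l = p")
      case True
      then have "\<not> carrying p (worker s v)" for v
        using unique[of v w] dequeue_partition by (auto simp: pc_defs)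
      then show ?thesis using dequeue_partition True order by (auto simp: defs)
    qed (use dequeue_partition order in \<open>auto simp: defs\<close>)
  next
    case (dequeue_partition_empty w l)
    with queue_nonempty[OF assms(2,3)] show ?thesis by blast
  next
    case (operate_begin w l)
    then have part_l: "part (snd (wtuple l)) = wp l" using carried[of w] by (simp add: carrying_def)
    show ?thesis
    proof (cases "wp l = p")
      case True
      then have "v = w" if "carrying p (worker s v)" for v
        using unique[of v w] operate_begin that by (auto simp: pc_defs)
      moreover have "A p = E p @ wtuple l # partitionQueues s p \<and> B p = E p"
        using operate_begin True order by (auto simp: in_order_def)
      ultimately show ?thesis using operate_begin True part_l by (auto simp: defs)
    qed (use operate_begin part_l order in \<open>auto simp: defs\<close>)
  next
    case (operate_end w l)
    then have part_l: "part (snd (wtuple l)) = wp l" using carried[of w] by (simp add: carrying_def)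
    show ?thesis
    proof (cases "wp l = p")
      case True
      then have "v = w" if "carrying p (worker s v)" for v
        using unique[of v w] operate_end that by (auto simp: pc_defs)
      moreover have "A p = E p @ wtuple l # partitionQueues s p \<and> B p = E p @ [wtuple l]"
        using operate_end True order by (auto simp: in_order_def)
      ultimately show ?thesis using operate_end True part_l by (auto simp: defs)
    qed (use operate_end part_l order in \<open>auto simp: defs\<close>)
  qed (use order in \<open>auto simp: set_worker_def carrying_def elim!: in_order_cong split: if_splits\<close>)
qed

lemma worker_unchanged:
  "step part s a s' \<Longrightarrow> \<not> by_worker w a \<Longrightarrow> worker s' w = worker s w"
  by (erule step.cases) (auto simp: set_worker_def)

lemma upstream_unchanged:
  "step part s a s' \<Longrightarrow> \<not> by_upstream a \<Longrightarrow> upstream s' = upstream s"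
  by (erule step.cases) (auto simp: set_worker_def)

lemma becomes_busy:
  assumes "step part s a s'" "\<not> busy p (worker s w)" "busy p (worker s' w)"
  shows "wpc (worker s' w) = DequeuePartition"
  using assms by cases (auto simp: set_worker_def busy_def split: if_splits)

lemma worker_step_cases:
  assumes "step part s a s'" "by_worker w a"
  shows
    "wpc (worker s w) = DequeueMaster \<Longrightarrow> masterQueue s = q # qs \<Longrightarrow>
      adding q (worker s' w) \<and> masterQueue s' = qs"
    "wpc (worker s w) = FetchAdd \<Longrightarrow>
      wpc (worker s' w) = (if count s (wp (worker s w)) = 0 then DequeuePartition else DequeueMaster) \<and>
      wp (worker s' w) = wp (worker s w)"
    "wpc (worker s w) = DequeuePartition \<Longrightarrow>
      wpc (worker s' w) = CallOperate \<and> wp (worker s' w) = wp (worker s w)"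
    "wpc (worker s w) = CallOperate \<Longrightarrow>
      wpc (worker s' w) = Operating \<and> wp (worker s' w) = wp (worker s w)"
    "wpc (worker s w) = Operating \<Longrightarrow>
      a = OperateEnd w (wtuple (worker s w)) \<and>
      wpc (worker s' w) = FetchSub \<and> wp (worker s' w) = wp (worker s w)"
    "wpc (worker s w) = FetchSub \<Longrightarrow>
      wpc (worker s' w) = (if count s (wp (worker s w)) > 1 then DequeuePartition else DequeueMaster) \<and>
      wp (worker s' w) = wp (worker s w) \<and>
      count s' = (count s)(wp (worker s w) := count s (wp (worker s w)) - 1) \<and>
      (\<forall>v. v \<noteq> w \<longrightarrow> worker s' v = worker s v)"
  using assms(2) by (cases rule: step.cases[OF assms(1)]; auto simp: set_worker_def adding_def)+

lemma operate_begin_inv: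
  "step part s (OperateBegin w x) s' \<Longrightarrow> wpc (worker s w) = CallOperate \<and> wtuple (worker s w) = x"
  by (erule step.cases) auto

lemma operate_end_inv:
  "step part s (OperateEnd w x) s' \<Longrightarrow> wpc (worker s w) = Operating \<and> wtuple (worker s w) = x"
  by (erule step.cases) auto

lemma masterQueue_grows:
  assumes "step part s a s'" "masterQueue s \<noteq> []"
    and "\<And>w. by_worker w a \<Longrightarrow> wpc (worker s w) \<noteq> DequeueMaster"
  shows "\<exists>zs. masterQueue s' = masterQueue s @ zs"
  using assms by cases (auto simp: set_worker_def)

text \<open>Variant for the termination of the loop of \<open>p\<close> while no token is dequeued.\<close>

definition dequeued_tokens :: "'p \<Rightarrow> ('w, 'p, 'd) state \<Rightarrow> int" where
  "dequeued_tokens p s = num (adding p) (worker s) + count s p"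

lemma dequeued_tokens_antimono:
  assumes "step part s a s'" "finitely_active (worker s)"
    and "\<And>w. by_worker w a \<Longrightarrow> wpc (worker s w) \<noteq> DequeueMaster"
  shows "dequeued_tokens p s' \<le> dequeued_tokens p s"
  using assms(1)
proof cases
  case (fetch_add w l c)
  then show ?thesis
    by (cases "p = wp l")
      (simp_all add: dequeued_tokens_def set_worker_def num_pc_upd[OF assms(2)] adding_def)
next
  case (dequeue_master w l q qs)
  with assms(3)[of w] show ?thesis by simp
qed (simp_all add: dequeued_tokens_def set_worker_def num_pc_upd[OF assms(2)] adding_def)

lemma dequeued_tokens_fetch_sub:
  assumes "step part s a s'" "finitely_active (worker s)" "by_worker w a"
    and "wpc (worker s w) = FetchSub" "wp (worker s w) = p"
  shows "dequeued_tokens p s' < dequeued_tokens p s"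
  using assms(1)
proof cases
  case (fetch_sub v l c)
  with assms(3-) show ?thesis
    by (auto simp: dequeued_tokens_def set_worker_def num_pc_upd[OF assms(2)] adding_def)
qed (use assms(3-) in \<open>auto simp: set_worker_def\<close>)

lemma in_arrives: "x \<in> set (arrives part p a) \<longleftrightarrow> a = Arrive x \<and> part (snd x) = p"
  by (cases "(part, p, a)" rule: arrives.cases) auto

lemma in_begins: "x \<in> set (begins part p a) \<longleftrightarrow> (\<exists>w. a = OperateBegin w x) \<and> part (snd x) = p"
  by (cases "(part, p, a)" rule: begins.cases) auto

lemma in_ends: "x \<in> set (ends part p a) \<longleftrightarrow> (\<exists>w. a = OperateEnd w x) \<and> part (snd x) = p"
  by (cases "(part, p, a)" rule: ends.cases) auto

locale hybrid_run =
  fixes part :: "'d \<Rightarrow> 'p"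
    and \<sigma> :: "nat \<Rightarrow> ('w, 'p, 'd) state"
    and \<alpha> :: "nat \<Rightarrow> ('w, 'd) action"
  assumes run: "run part \<sigma> \<alpha>"
begin

definition history :: "(('w, 'd) action \<Rightarrow> 'd input list) \<Rightarrow> nat \<Rightarrow> 'd input list" where
  "history f i = concat (map (\<lambda>j. f (\<alpha> j)) [0..<i])"

lemma in_history: "x \<in> set (history f i) \<longleftrightarrow> (\<exists>j<i. x \<in> set (f (\<alpha> j)))"
  by (auto simp: history_def)

lemma history_0: "history f 0 = []"
  and history_Suc: "history f (Suc i) = history f i @ f (\<alpha> i)"
  by (simp_all add: history_def)

lemma history_mono: "i \<le> j \<Longrightarrow> \<exists>zs. history f j = history f i @ zs"
  by (induction j rule: dec_induct) (auto simp: history_Suc)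

abbreviation "arrived i p \<equiv> history (arrives part p) i"
abbreviation "begun i p \<equiv> history (begins part p) i"
abbreviation "ended i p \<equiv> history (ends part p) i"

lemma step: "step part (\<sigma> i) (\<alpha> i) (\<sigma> (Suc i))"
  using run by (simp add: run_def)

lemma initial: "initial (\<sigma> 0)"
  using run by (simp add: run_def)

lemma owned: "owned (\<sigma> i)"
proof (induction i)
  case 0
  then show ?case using initial
    by (simp add: initial_def owned_def finitely_active_def num_def busy_def)
qed (rule owned_step[OF step])

lemma finitely_active: "finitely_active (worker (\<sigma> i))"
  using owned by (simp add: owned_def)

lemma balanced: "balanced (\<sigma> i)"
proof (induction i)
  case 0
  then show ?case using initial
    by (simp add: initial_def balanced_def num_def holding_def adding_def)
qed (rule balanced_step[OF step owned])

lemma fresh: "fresh part (\<sigma> i) (arrived i)"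
proof (induction i)
  case 0
  then show ?case using initial by (simp add: initial_def fresh_def history_0)
next
  case (Suc i)
  from fresh_step[OF step this] show ?case by (simp add: history_Suc)
qed

lemma in_order: "in_order (\<sigma> i) p (arrived i p) (begun i p) (ended i p)"
proof (induction i arbitrary: p)
  case 0
  then show ?case using initial by (simp add: initial_def in_order_def history_0)
next
  case (Suc i)
  from in_order_step[OF step owned balanced fresh this] show ?case by (simp add: history_Suc)
qed

lemma distinct_arrived: "distinct (arrived i p)"
  using fresh by (simp add: fresh_def)

lemma part_arrived: "x \<in> set (arrived i p) \<Longrightarrow> part (snd x) = p"
  using fresh by (simp add: fresh_def)

lemma arrived_split:
  assumes "carrying p (worker (\<sigma> i) w)"
  shows "arrived i p = ended i p @ wtuple (worker (\<sigma> i) w) # partitionQueues (\<sigma> i) p"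
    and "part (snd (wtuple (worker (\<sigma> i) w))) = p"
proof -
  show "arrived i p = ended i p @ wtuple (worker (\<sigma> i) w) # partitionQueues (\<sigma> i) p"
    using assms in_order[of i p] by (auto simp: in_order_def carrying_def)
  then show "part (snd (wtuple (worker (\<sigma> i) w))) = p" by (intro part_arrived[where i = i]) simp
qed

lemma operate_beginD:
  assumes "\<alpha> i = OperateBegin w x"
  shows "arrived i (part (snd x)) = ended i (part (snd x)) @ x # partitionQueues (\<sigma> i) (part (snd x))"
    and "begun i (part (snd x)) = ended i (part (snd x))"
proof -
  from step[of i] have x: "wpc (worker (\<sigma> i) w) = CallOperate" "wtuple (worker (\<sigma> i) w) = x"
    unfolding assms by (blast dest: operate_begin_inv)+
  let ?p = "wp (worker (\<sigma> i) w)"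
  from x have "carrying ?p (worker (\<sigma> i) w)" by (simp add: carrying_def)
  note split = arrived_split[OF this]
  from split x show "arrived i (part (snd x)) =
      ended i (part (snd x)) @ x # partitionQueues (\<sigma> i) (part (snd x))" by simp
  show "begun i (part (snd x)) = ended i (part (snd x))"
    using in_order[of i ?p] x split by (auto simp: in_order_def)
qed

lemma operate_endD:
  assumes "\<alpha> i = OperateEnd w x"
  shows "arrived i (part (snd x)) = ended i (part (snd x)) @ x # partitionQueues (\<sigma> i) (part (snd x))"
proof -
  from step[of i] have x: "wpc (worker (\<sigma> i) w) = Operating" "wtuple (worker (\<sigma> i) w) = x"
    unfolding assms by (blast dest: operate_end_inv)+
  then have "carrying (wp (worker (\<sigma> i) w)) (worker (\<sigma> i) w)" by (simp add: carrying_def)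
  from arrived_split[OF this] x show ?thesis by simp
qed

lemma operating_exclusive:
  assumes "operating_on (\<sigma> i) w x" "operating_on (\<sigma> i) w' x'" "part (snd x) = part (snd x')"
  shows "w = w'"
proof -
  have "busy (part (snd (wtuple (worker (\<sigma> i) v)))) (worker (\<sigma> i) v)"
    if "wpc (worker (\<sigma> i) v) = Operating" for v
    using that arrived_split(2)[of "wp (worker (\<sigma> i) v)" i v] by (auto simp: pc_defs)
  with assms show ?thesis unfolding operating_on_def
    by (metis owned_unique[OF owned])
qed

lemma begin_after_arrive:
  assumes "\<alpha> j = OperateBegin w x"
  shows "\<exists>i<j. \<alpha> i = Arrive x"
proof -
  have "x \<in> set (arrived j (part (snd x)))" using operate_beginD[OF assms] by simp
  then show ?thesis by (auto simp: in_history in_arrives)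
qed

lemma begin_once:
  assumes "\<alpha> j = OperateBegin w x" "\<alpha> j' = OperateBegin w' x"
  shows "j = j'"
proof -
  have "\<not> j < j'" if "\<alpha> j = OperateBegin w x" "\<alpha> j' = OperateBegin w' x" for j j' w w'
  proof
    assume "j < j'"
    then have "x \<in> set (begun j' (part (snd x)))" using that(1) by (auto simp: in_history intro!: exI[of _ j])
    then show False using operate_beginD[OF that(2)] distinct_arrived[of "part (snd x)" j'] by simp
  qed
  from this[OF assms] this[OF assms(2,1)] show ?thesis by simp
qed

lemma end_once:
  assumes "\<alpha> j = OperateEnd w x" "\<alpha> j' = OperateEnd w' x"
  shows "j = j'"
proof -
  have "\<not> j < j'" if "\<alpha> j = OperateEnd w x" "\<alpha> j' = OperateEnd w' x" for j j' w w'
  proof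
    assume "j < j'"
    then have "x \<in> set (ended j' (part (snd x)))" using that(1) by (auto simp: in_history intro!: exI[of _ j])
    then show False using operate_endD[OF that(2)] distinct_arrived[of "part (snd x)" j'] by simp
  qed
  from this[OF assms] this[OF assms(2,1)] show ?thesis by simp
qed

lemma arrive_once:
  assumes "\<alpha> j = Arrive x" "\<alpha> j' = Arrive x"
  shows "j = j'"
proof -
  have "\<not> j < j'" if "\<alpha> j = Arrive x" "\<alpha> j' = Arrive x" for j j'
  proof
    assume "j < j'"
    then have "x \<in> set (arrived j' (part (snd x)))" using that(1) by (auto simp: in_history intro!: exI[of _ j])
    then show False
      using that(2) distinct_arrived[of "part (snd x)" "Suc j'"] by (simp add: history_Suc)
  qed
  from this[OF assms] this[OF assms(2,1)] show ?thesis by simp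
qed

lemma ended_iff: "x \<in> set (ended i (part (snd x))) \<longleftrightarrow> (\<exists>j<i. \<exists>w. \<alpha> j = OperateEnd w x)"
  by (simp add: in_history in_ends)

lemma begun_iff: "x \<in> set (begun i (part (snd x))) \<longleftrightarrow> (\<exists>j<i. \<exists>w. \<alpha> j = OperateBegin w x)"
  by (simp add: in_history in_begins)

lemma ended_before_begin:
  assumes "\<alpha> i = Arrive x" "\<alpha> i' = Arrive x'" "i < i'" "\<alpha> j' = OperateBegin w' x'"
    and same: "part (snd x) = part (snd x')"
  shows "\<exists>j<j'. \<exists>w. \<alpha> j = OperateEnd w x"
proof -
  let ?p = "part (snd x')"
  have "i' < j'" using begin_after_arrive[OF assms(4)] arrive_once[OF assms(2)] by auto
  then obtain zs where zs: "arrived j' ?p = arrived (Suc i') ?p @ zs"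
    using history_mono[of "Suc i'" j'] by auto
  have eq: "arrived i' ?p @ x' # zs = ended j' ?p @ x' # partitionQueues (\<sigma> j') ?p"
    using zs operate_beginD(1)[OF assms(4)] assms(2) by (simp add: history_Suc)
  have "distinct (arrived i' ?p @ x' # zs)"
    using distinct_arrived[of ?p j'] zs assms(2) by (simp add: history_Suc)
  then have "x' \<notin> set (arrived i' ?p)" "x' \<notin> set zs" by simp_all
  from append_Cons_eq_iff[OF this] eq have "arrived i' ?p = ended j' ?p" by blast
  moreover have "x \<in> set (arrived i' ?p)"
    using assms(1,3) same by (auto simp: in_history intro!: exI[of _ i])
  ultimately show ?thesis using ended_iff[of x j'] same by simp
qed

lemma end_after_begin:
  assumes "\<alpha> j = OperateEnd w x"
  shows "\<exists>i. \<exists>w. \<alpha> i = OperateBegin w x"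
proof -
  let ?p = "part (snd x)"
  have "x \<in> set (ended (Suc j) ?p)" using assms by (simp add: history_Suc)
  moreover have "set (ended i p) \<subseteq> set (begun i p)" for i p
  proof (cases "\<exists>w. carrying p (worker (\<sigma> i) w)")
    case True
    then show ?thesis using in_order[of i p] by (auto simp: in_order_def carrying_def)
  qed (use in_order[of i p] in \<open>simp add: in_order_def\<close>)
  ultimately show ?thesis using begun_iff by blast
qed

end

lemma least_from:
  fixes i :: nat
  assumes "\<exists>j\<ge>i. P j"
  obtains j where "j \<ge> i" "P j" "\<And>k. i \<le> k \<Longrightarrow> k < j \<Longrightarrow> \<not> P k"
proof -
  from assms have "\<exists>j. i \<le> j \<and> P j" by blast
  then obtain j where "i \<le> j \<and> P j" "\<forall>k<j. \<not> (i \<le> k \<and> P k)"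
    by (rule exE[OF exists_least_iff[THEN iffD1]]) blast
  then show ?thesis using that by blast
qed

locale fair_run = hybrid_run +
  assumes fair: "fair \<sigma> \<alpha>"
begin

lemma worker_acts:
  assumes "wpc (worker (\<sigma> i) w) \<noteq> NotConsuming"
  obtains j where "j \<ge> i" "by_worker w (\<alpha> j)" "worker (\<sigma> j) w = worker (\<sigma> i) w"
proof -
  from assms fair have "\<exists>j\<ge>i. by_worker w (\<alpha> j)" by (auto simp: fair_def)
  from least_from[OF this] obtain j where
    j: "j \<ge> i" "by_worker w (\<alpha> j)" "\<And>k. i \<le> k \<Longrightarrow> k < j \<Longrightarrow> \<not> by_worker w (\<alpha> k)" by blast
  have "k \<le> j \<Longrightarrow> worker (\<sigma> k) w = worker (\<sigma> i) w" if "i \<le> k" for k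
    using that by (induction k rule: dec_induct) (auto simp: j(3) worker_unchanged[OF step])
  with j that show ?thesis by blast
qed

lemma upstream_acts:
  assumes "upc (upstream (\<sigma> i)) \<noteq> NotAdding"
  obtains j where "j \<ge> i" "by_upstream (\<alpha> j)" "upstream (\<sigma> j) = upstream (\<sigma> i)"
proof -
  from assms fair have "\<exists>j\<ge>i. by_upstream (\<alpha> j)" by (auto simp: fair_def)
  from least_from[OF this] obtain j where
    j: "j \<ge> i" "by_upstream (\<alpha> j)" "\<And>k. i \<le> k \<Longrightarrow> k < j \<Longrightarrow> \<not> by_upstream (\<alpha> k)" by blast
  have "k \<le> j \<Longrightarrow> upstream (\<sigma> k) = upstream (\<sigma> i)" if "i \<le> k" for k
    using that by (induction k rule: dec_induct) (auto simp: j(3) upstream_unchanged[OF step])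
  with j that show ?thesis by blast
qed

lemma arrives_eventually:
  assumes "\<alpha> i = CallAddInput x"
  shows "\<exists>j. \<alpha> j = Arrive x"
proof -
  let ?u = "\<lambda>i. upstream (\<sigma> i)"
  from step[of i] have 1: "upc (?u (Suc i)) = GetPartition" "utuple (?u (Suc i)) = x"
    unfolding assms by (auto elim: step.cases)
  then obtain j where "by_upstream (\<alpha> j)" "?u j = ?u (Suc i)"
    using upstream_acts[of "Suc i"] by (metis upstream_pc.distinct(1))
  with step[of j] 1 have 2: "upc (?u (Suc j)) = EnqueuePartition" "utuple (?u (Suc j)) = x"
    by (auto elim!: step.cases)
  then obtain k where "by_upstream (\<alpha> k)" "?u k = ?u (Suc j)"
    using upstream_acts[of "Suc j"] by (metis upstream_pc.distinct(3))
  with step[of k] 2 have "\<alpha> k = Arrive x"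
    by (auto elim!: step.cases)
  then show ?thesis ..
qed

lemma reaches_FetchSub:
  assumes "busy p (worker (\<sigma> i) w)"
  obtains j where "j \<ge> i" "by_worker w (\<alpha> j)"
    "wpc (worker (\<sigma> j) w) = FetchSub" "wp (worker (\<sigma> j) w) = p"
    "wpc (worker (\<sigma> i) w) \<noteq> FetchSub \<Longrightarrow>
       \<exists>k x. i \<le> k \<and> \<alpha> k = OperateEnd w x \<and> part (snd x) = p"
proof -
  define W where "W j = worker (\<sigma> j) w" for j
  have next_step: "\<exists>j\<ge>i. by_worker w (\<alpha> j) \<and> W j = W i" if "wpc (W i) \<noteq> NotConsuming" for i
    using worker_acts[of i w] that unfolding W_def by metis
  have cases_step: "wpc (W j) = DequeuePartition \<longrightarrow> wpc (W (Suc j)) = CallOperate \<and> wp (W (Suc j)) = wp (W j)"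
    "wpc (W j) = CallOperate \<longrightarrow> wpc (W (Suc j)) = Operating \<and> wp (W (Suc j)) = wp (W j)"
    "wpc (W j) = Operating \<longrightarrow> wpc (W (Suc j)) = FetchSub \<and> wp (W (Suc j)) = wp (W j) \<and>
      \<alpha> j = OperateEnd w (wtuple (W j))"
    if "by_worker w (\<alpha> j)" for j
    using worker_step_cases(3-5)[OF step that] unfolding W_def by blast+
  have sub: "\<exists>j\<ge>i. by_worker w (\<alpha> j) \<and> wpc (W j) = FetchSub \<and> wp (W j) = p"
    if "wpc (W i) = FetchSub" "wp (W i) = p" for i
    using next_step[of i] that by auto
  have oper: "\<exists>k\<ge>i. \<exists>j\<ge>k. by_worker w (\<alpha> j) \<and> wpc (W j) = FetchSub \<and> wp (W j) = p \<and>
      (\<exists>x. \<alpha> k = OperateEnd w x \<and> part (snd x) = p)"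
    if oper: "wpc (W i) = Operating" "wp (W i) = p" for i
  proof -
    from next_step[of i] oper obtain k where k: "k \<ge> i" "by_worker w (\<alpha> k)" "W k = W i" by auto
    then have "part (snd (wtuple (W k))) = p"
      using arrived_split(2)[of p k w] oper by (simp add: W_def carrying_def)
    moreover have k': "wpc (W (Suc k)) = FetchSub" "wp (W (Suc k)) = p"
      "\<alpha> k = OperateEnd w (wtuple (W k))"
      using cases_step(3)[OF k(2)] k(3) oper by simp_all
    moreover obtain j where "j \<ge> Suc k" "by_worker w (\<alpha> j) \<and> wpc (W j) = FetchSub \<and> wp (W j) = p"
      using sub[OF k'(1,2)] by blast
    ultimately show ?thesis using k(1) by (intro exI[of _ k] conjI exI[of _ j]) simp_all
  qed
  have call: "\<exists>k\<ge>i. \<exists>j\<ge>k. by_worker w (\<alpha> j) \<and> wpc (W j) = FetchSub \<and> wp (W j) = p \<and>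
      (\<exists>x. \<alpha> k = OperateEnd w x \<and> part (snd x) = p)"
    if "wpc (W i) = CallOperate" "wp (W i) = p" for i
  proof -
    from next_step[of i] that obtain k where k: "k \<ge> i" "by_worker w (\<alpha> k)" "W k = W i" by auto
    with oper[of "Suc k"] cases_step(2)[OF k(2)] that show ?thesis by (metis Suc_leD order.trans)
  qed
  have deq: "\<exists>k\<ge>i. \<exists>j\<ge>k. by_worker w (\<alpha> j) \<and> wpc (W j) = FetchSub \<and> wp (W j) = p \<and>
      (\<exists>x. \<alpha> k = OperateEnd w x \<and> part (snd x) = p)"
    if "wpc (W i) = DequeuePartition" "wp (W i) = p" for i
  proof -
    from next_step[of i] that obtain k where k: "k \<ge> i" "by_worker w (\<alpha> k)" "W k = W i" by auto
    with call[of "Suc k"] cases_step(1)[OF k(2)] that show ?thesis by (metis Suc_leD order.trans)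
  qed
  show ?thesis
  proof (cases "wpc (W i) = FetchSub")
    case True
    with sub[of i] assms that show ?thesis unfolding W_def busy_def by blast
  next
    case False
    then have "\<exists>k\<ge>i. \<exists>j\<ge>k. by_worker w (\<alpha> j) \<and> wpc (W j) = FetchSub \<and> wp (W j) = p \<and>
      (\<exists>x. \<alpha> k = OperateEnd w x \<and> part (snd x) = p)"
      using assms deq[of i] call[of i] oper[of i] unfolding W_def busy_def by blast
    then obtain k j x where "k \<ge> i" "j \<ge> k" "by_worker w (\<alpha> j)" "wpc (W j) = FetchSub" "wp (W j) = p"
      "\<alpha> k = OperateEnd w x" "part (snd x) = p" by blast
    then show ?thesis unfolding W_def by (intro that[of j]) (auto simp del: split_paired_Ex)
  qed
qed

lemma dequeues_eventually:
  assumes "masterQueue (\<sigma> i) = q # qs"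
  obtains j w zs where "j \<ge> i" "adding q (worker (\<sigma> (Suc j)) w)" "masterQueue (\<sigma> (Suc j)) = qs @ zs"
proof -
  define dequeues where
    "dequeues j \<longleftrightarrow> (\<exists>w. by_worker w (\<alpha> j) \<and> wpc (worker (\<sigma> j) w) = DequeueMaster)" for j
  have grows: "\<exists>zs. masterQueue (\<sigma> j) = q # qs @ zs"
    if "i \<le> j" "\<And>k. i \<le> k \<Longrightarrow> k < j \<Longrightarrow> \<not> dequeues k" for j
    using that
  proof (induction j rule: dec_induct)
    case (step j)
    then obtain zs where zs: "masterQueue (\<sigma> j) = q # qs @ zs" by auto
    then show ?case
      using masterQueue_grows[OF hybrid_run.step[OF hybrid_run_axioms], of j] step
      by (auto simp: dequeues_def)
  qed (use assms in simp)
  have "\<exists>j\<ge>i. dequeues j"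
  proof (rule ccontr)
    assume "\<not> ?thesis"
    then have no: "\<not> dequeues j" if "j \<ge> i" for j using that by blast
    have not_deq: "wpc (worker (\<sigma> j) w) \<noteq> DequeueMaster" if "j \<ge> i" for j w
    proof
      assume deq: "wpc (worker (\<sigma> j) w) = DequeueMaster"
      then obtain k where "k \<ge> j" "by_worker w (\<alpha> k)" "worker (\<sigma> k) w = worker (\<sigma> j) w"
        using worker_acts[of j w] by auto
      with no[of k] that deq show False unfolding dequeues_def by auto
    qed
    have not_busy: "\<not> busy p (worker (\<sigma> j) w)" if "j \<ge> i" for j p w
      using that
    proof (induction "nat (dequeued_tokens p (\<sigma> j))" arbitrary: j rule: less_induct)
      case less
      show ?case
      proof
        assume "busy p (worker (\<sigma> j) w)"
        then obtain k where k: "k \<ge> j" "by_worker w (\<alpha> k)"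
          "wpc (worker (\<sigma> k) w) = FetchSub" "wp (worker (\<sigma> k) w) = p"
          by (rule reaches_FetchSub)
        have "dequeued_tokens p (\<sigma> k) \<le> dequeued_tokens p (\<sigma> j)"
          using k(1)
        proof (induction k rule: dec_induct)
          case (step m)
          have "dequeued_tokens p (\<sigma> (Suc m)) \<le> dequeued_tokens p (\<sigma> m)"
            using no[of m] step(1) less.prems
            by (intro dequeued_tokens_antimono[OF hybrid_run.step[OF hybrid_run_axioms] finitely_active])
              (auto simp: dequeues_def)
          with step show ?case by simp
        qed simp
        moreover have "dequeued_tokens p (\<sigma> (Suc k)) < dequeued_tokens p (\<sigma> k)"
          using dequeued_tokens_fetch_sub[OF step finitely_active k(2-4)] .
        moreover have "dequeued_tokens p (\<sigma> (Suc k)) \<ge> 0"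
          using owned[of "Suc k"] by (simp add: dequeued_tokens_def owned_def num_def)
        ultimately have "\<not> busy p (worker (\<sigma> (Suc k)) w)"
          using less k(1) by simp
        then show False
          using worker_step_cases(6)[OF step k(2,3)] k(1,4) not_deq[of "Suc k" w] less.prems
          by (auto simp: busy_def split: if_splits)
      qed
    qed
    have not_adding: "wpc (worker (\<sigma> j) w) \<noteq> FetchAdd" if "j \<ge> i" for j w
    proof
      assume add: "wpc (worker (\<sigma> j) w) = FetchAdd"
      then obtain k where k: "k \<ge> j" "by_worker w (\<alpha> k)" "worker (\<sigma> k) w = worker (\<sigma> j) w"
        using worker_acts[of j w] by auto
      with worker_step_cases(2)[OF step k(2)] add not_deq[of "Suc k" w] not_busy[of "Suc k" "wp (worker (\<sigma> j) w)" w] that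
      show False by (auto simp: busy_def split: if_splits)
    qed
    obtain j where j: "j \<ge> i" "masterQueue (\<sigma> j) = [] \<or> (\<exists>w. wpc (worker (\<sigma> j) w) \<noteq> NotConsuming)"
      using fair unfolding fair_def by blast
    then obtain w where "wpc (worker (\<sigma> j) w) \<noteq> NotConsuming" using grows[of j] no by auto
    with not_deq[OF j(1), of w] not_busy[OF j(1), of _ w] not_adding[OF j(1), of w] show False
      by (cases "wpc (worker (\<sigma> j) w)") (auto simp: busy_def)
  qed
  from least_from[OF this] obtain j where
    j: "j \<ge> i" "dequeues j" "\<And>k. i \<le> k \<Longrightarrow> k < j \<Longrightarrow> \<not> dequeues k" by blast
  from grows[OF j(1,3)] obtain zs where "masterQueue (\<sigma> j) = q # qs @ zs" by blast
  with j(2) worker_step_cases(1)[OF step] that[OF j(1)] show ?thesis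
    unfolding dequeues_def by metis
qed

lemma token_reached:
  assumes "p \<in> set (masterQueue (\<sigma> i))"
  shows "\<exists>j\<ge>i. \<exists>w. adding p (worker (\<sigma> j) w)"
proof -
  obtain us vs where "masterQueue (\<sigma> i) = us @ p # vs" using assms by (auto dest: split_list)
  then show ?thesis
  proof (induction us arbitrary: i vs)
    case Nil
    then have "masterQueue (\<sigma> i) = p # vs" by simp
    then obtain j w where "j \<ge> i" "adding p (worker (\<sigma> (Suc j)) w)" by (rule dequeues_eventually)
    then show ?case by (meson le_SucI)
  next
    case (Cons u us)
    then have "masterQueue (\<sigma> i) = u # us @ p # vs" by simp
    then obtain j zs where j: "j \<ge> i" "masterQueue (\<sigma> (Suc j)) = (us @ p # vs) @ zs"
      by (rule dequeues_eventually)
    from Cons.IH[of "Suc j" "vs @ zs"] j show ?case by (simp, meson Suc_leD order.trans)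
  qed
qed

lemma ends_eventually:
  assumes "\<alpha> i = Arrive x"
  shows "\<exists>j w. \<alpha> j = OperateEnd w x"
proof (rule ccontr)
  assume none: "\<nexists>j w. \<alpha> j = OperateEnd w x"
  define p where "p = part (snd x)"
  have arr: "x \<in> set (arrived j p)" if "j > i" for j
    using assms that by (auto simp: in_history in_arrives p_def)
  have not_ended: "x \<notin> set (ended j p)" for j
    using none ended_iff[of x j] by (auto simp: p_def)
  have prefix: "\<exists>zs. arrived j p = ended j p @ zs" for j
  proof (cases "\<exists>w. carrying p (worker (\<sigma> j) w)")
    case True
    then show ?thesis using arrived_split by blast
  qed (use in_order[of j p] in \<open>simp add: in_order_def\<close>)
  have bound: "length (ended j p) \<le> length (arrived (Suc i) p)" if "j > i" for j
  proof (rule ccontr)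
    assume long: "\<not> ?thesis"
    obtain zs where "arrived j p = ended j p @ zs" using prefix by blast
    moreover obtain ys where "arrived j p = arrived (Suc i) p @ ys"
      using history_mono[of "Suc i" j] \<open>j > i\<close> by (metis Suc_leI)
    ultimately have "arrived (Suc i) p @ ys = ended j p @ zs" by simp
    with long have "arrived (Suc i) p = take (length (arrived (Suc i) p)) (ended j p)"
      by (simp add: append_eq_append_conv_if)
    then have "set (arrived (Suc i) p) \<subseteq> set (ended j p)" by (metis set_take_subset)
    with arr[of "Suc i"] not_ended show False by blast
  qed
  obtain m where m: "m > i" "\<And>j. j > i \<Longrightarrow> length (ended j p) \<le> length (ended m p)"
    using ex_has_greatest_nat[of "\<lambda>j. j > i" "Suc i" "\<lambda>j. length (ended j p)"] bound
    by (metis le_imp_less_Suc lessI)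
  have no_end: "part (snd y) \<noteq> p" if "j \<ge> m" "\<alpha> j = OperateEnd w y" for j w y
  proof
    assume "part (snd y) = p"
    with that(2) have "length (ended (Suc j) p) = Suc (length (ended j p))"
      by (simp add: history_Suc)
    moreover obtain zs where "ended j p = ended m p @ zs"
      using history_mono[OF \<open>j \<ge> m\<close>] by blast
    moreover have "length (ended (Suc j) p) \<le> length (ended m p)" using m that(1) by simp
    ultimately show False by simp
  qed
  have only_sub: "wpc (worker (\<sigma> j) w) = FetchSub" if "j \<ge> m" "busy p (worker (\<sigma> j) w)" for j w
    using reaches_FetchSub[OF that(2)] no_end that(1) by (metis order.trans)
  have "\<exists>n\<ge>m. \<forall>w. \<not> busy p (worker (\<sigma> n) w)"
  proof (rule ccontr)
    assume "\<not> ?thesis"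
    then have ex: "\<exists>w. busy p (worker (\<sigma> n) w)" if "n \<ge> m" for n using that by blast
    then obtain w where "busy p (worker (\<sigma> m) w)" by blast
    then obtain k where k: "k \<ge> m" "by_worker w (\<alpha> k)"
      "wpc (worker (\<sigma> k) w) = FetchSub" "wp (worker (\<sigma> k) w) = p" by (rule reaches_FetchSub)
    note next_state = worker_step_cases(6)[OF step k(2,3)]
    have "count (\<sigma> k) p \<le> 1"
      using next_state only_sub[of "Suc k" w] k by (auto simp: busy_def split: if_splits)
    moreover have "count (\<sigma> (Suc k)) p > 0"
      using owned_count_pos[OF owned] ex[of "Suc k"] k(1) by simp
    ultimately show False using next_state k(4) by simp
  qed
  then obtain n where n: "n \<ge> m" "\<And>w. \<not> busy p (worker (\<sigma> n) w)" by blast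
  have idle: "\<not> busy p (worker (\<sigma> j) w)" if "j \<ge> n" for j w
    using that
  proof (induction j arbitrary: w rule: dec_induct)
    case (step j)
    then show ?case
      using becomes_busy[OF hybrid_run.step[OF hybrid_run_axioms], of p j w]
        only_sub[of "Suc j" w] n(1) by fastforce
  qed (rule n(2))
  have none_adding: "\<not> adding p (worker (\<sigma> j) w)" if "j \<ge> n" for j w
  proof
    assume add: "adding p (worker (\<sigma> j) w)"
    then obtain k where k: "k \<ge> j" "by_worker w (\<alpha> k)" "worker (\<sigma> k) w = worker (\<sigma> j) w"
      using worker_acts[of j w] by (auto simp: adding_def)
    have "count (\<sigma> k) p = 0"
      using owned_count_pos[OF owned, of k p] idle[of k] owned[of k] k(1) that
      by (auto simp: owned_def intro: order.antisym)
    then have "busy p (worker (\<sigma> (Suc k)) w)"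
      using worker_step_cases(2)[OF step k(2)] k(3) add by (simp add: pc_defs)
    with idle[of "Suc k"] k(1) that show False by simp
  qed
  obtain j where j: "j \<ge> n" "upc (upstream (\<sigma> j)) \<noteq> EnqueueMaster"
  proof (cases "upc (upstream (\<sigma> n)) = EnqueueMaster")
    case True
    then obtain k where "k \<ge> n" "by_upstream (\<alpha> k)" "upstream (\<sigma> k) = upstream (\<sigma> n)"
      using upstream_acts[of n] by auto
    with step[of k] True have "upc (upstream (\<sigma> (Suc k))) \<noteq> EnqueueMaster"
      by (auto elim!: step.cases)
    with \<open>k \<ge> n\<close> that[of "Suc k"] show ?thesis by simp
  qed (use that in blast)
  have "\<not> carrying p (worker (\<sigma> j) w)" "\<not> holding p (worker (\<sigma> j) w)" for w
    using idle[OF j(1)] by (auto simp: pc_defs)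
  then have "arrived j p = ended j p @ partitionQueues (\<sigma> j) p" "num (holding p) (worker (\<sigma> j)) = 0"
    using in_order[of j p] by (auto simp: in_order_def num_def)
  moreover have "num (adding p) (worker (\<sigma> j)) = 0" "count (\<sigma> j) p = 0"
    using none_adding[OF j(1)] owned_count_pos[OF owned, of j p] idle[OF j(1)] owned[of j]
    by (auto simp: num_def owned_def intro: order.antisym)
  moreover have "int (length (partitionQueues (\<sigma> j) p)) + num (holding p) (worker (\<sigma> j)) =
     int (count_list (masterQueue (\<sigma> j)) p) + num (adding p) (worker (\<sigma> j)) + count (\<sigma> j) p +
     of_bool (upc (upstream (\<sigma> j)) = EnqueueMaster \<and> up (upstream (\<sigma> j)) = p)"
    using balanced unfolding balanced_def by blast
  moreover have "x \<in> set (arrived j p)" using arr j(1) n(1) m(1) by simp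
  ultimately have "x \<in> set (partitionQueues (\<sigma> j) p)"
    "length (partitionQueues (\<sigma> j) p) = count_list (masterQueue (\<sigma> j)) p"
    using j(2) not_ended[of j] by auto
  then have "count_list (masterQueue (\<sigma> j)) p \<noteq> 0" by (metis length_pos_if_in_set less_irrefl)
  then have "p \<in> set (masterQueue (\<sigma> j))" by (simp add: count_list_0_iff)
  with token_reached[of p j] none_adding j(1) show False by (meson order.trans)
qed

end

theorem theorem4p1:
  fixes getKey :: "'d \<Rightarrow> 'k"
    and partitionOf :: "'k \<Rightarrow> 'p"
    and requiredState :: "'d \<Rightarrow> 's set"
    and \<sigma> :: "nat \<Rightarrow> ('w, 'p, 'd) state"
    and \<alpha> :: "nat \<Rightarrow> ('w, 'd) action"
  assumes "partitioned_stateful_operator getKey partitionOf requiredState"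
    and "run (getPartition getKey partitionOf) \<sigma> \<alpha>"
  shows
    "(\<forall>k i w w' x x'.
        operating_on (\<sigma> i) w x \<and> getKey (snd x) = k \<and>
        operating_on (\<sigma> i) w' x' \<and> getKey (snd x') = k \<longrightarrow> w = w') \<and>
     (\<forall>k.
        \<comment> \<open>in every run: only arrived tuples are processed, at most once, in order of arrival\<close>
        (\<forall>j w x. \<alpha> j = OperateBegin w x \<and> getKey (snd x) = k \<longrightarrow> (\<exists>i<j. \<alpha> i = Arrive x)) \<and>
        (\<forall>j j' w w' x. getKey (snd x) = k \<and>
           \<alpha> j = OperateBegin w x \<and> \<alpha> j' = OperateBegin w' x \<longrightarrow> j = j') \<and>
        (\<forall>i i' j' w' x x'. getKey (snd x) = k \<and> getKey (snd x') = k \<and>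
           \<alpha> i = Arrive x \<and> \<alpha> i' = Arrive x' \<and> i < i' \<and> \<alpha> j' = OperateBegin w' x' \<longrightarrow>
           (\<exists>j<j'. \<exists>w. \<alpha> j = OperateEnd w x)) \<and>
        \<comment> \<open>in every fair run: all tuples are processed exactly once\<close>
        (fair \<sigma> \<alpha> \<longrightarrow>
           (\<forall>i x. \<alpha> i = CallAddInput x \<and> getKey (snd x) = k \<longrightarrow>
              (\<exists>!j. \<exists>w. \<alpha> j = OperateBegin w x) \<and>
              (\<exists>!j. \<exists>w. \<alpha> j = OperateEnd w x))))"
proof -
  let ?part = "getPartition getKey partitionOf"
  interpret hybrid_run ?part \<sigma> \<alpha> by (unfold_locales) (rule assms(2))
  have same: "?part (snd x) = ?part (snd x')" if "getKey (snd x) = getKey (snd x')"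
    for x x' :: "'d input" using that by (simp add: getPartition_def)
  have once: "(\<exists>!j. \<exists>w. \<alpha> j = OperateBegin w x) \<and> (\<exists>!j. \<exists>w. \<alpha> j = OperateEnd w x)"
    if is_fair: "fair \<sigma> \<alpha>" and call: "\<alpha> i = CallAddInput x" for i x
  proof -
    interpret fair_run ?part \<sigma> \<alpha> by (unfold_locales) (rule is_fair)
    obtain j w where "\<alpha> j = OperateEnd w x"
      using arrives_eventually[OF call] ends_eventually by blast
    with end_after_begin[OF this] show ?thesis using begin_once end_once by blast
  qed
  show ?thesis
  proof (intro conjI allI impI, goal_cases)
    case (1 k i w w' x x')
    then show ?case using operating_exclusive same by metis
  next
    case (2 k j w x)
    then show ?case using begin_after_arrive by blast
  next
    case (3 k j j' w w' x)
    then show ?case using begin_once by blast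
  next
    case (4 k i i' j' w' x x')
    then show ?case using ended_before_begin same by metis
  next
    case (5 k i x)
    then show ?case using once by blast
  next
    case (6 k i x)
    then show ?case using once by blast
  qed
qed

end
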